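(* Let $p$ be a prime. (1) If $p\equiv 7\pmod{15}$ and $A,B,C,D$ are integers with $N_3(3+x+5(Ax+B))=p$ and $N_3(2+3x+5(x-1)(Cx+D))=p$, then $$M_{15}\big(1-x+x^3\Phi_3(x^3)+(1-x)\Phi_5(x)\Phi_{15}(x)(Ax+B)\big)=3^2p,$$ $$M_{15}\big(1-x^2+x^4+x^9+x^{10}+x^{13}+x^{14}+(x-1)\Phi_5(x)\Phi_{15}(x)(Cx+D)\big)=5^2p.$$ (2) If $p\equiv 13\pmod{15}$ and $A,B,C,D$ are integers with $N_3(4+3x+5(Ax+B))=p$ and $N_3(3-x+5(x-1)(Cx+D))=p$, then $$M_{15}\big(1-x^5-x^{11}+x^{12}+x^3\Phi_3(x^3)+(1-x)\Phi_5(x)\Phi_{15}(x)(Ax+B)\big)=3^2p,$$ $$M_{15}\big(1+x^3+x^6+x^9+x^{14}+(x-1)\Phi_5(x)\Phi_{15}(x)(Cx+D)\big)=5^2p.$$ (Such integers $A,B,C,D$ always exist.)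
   Context: $\omega_d=e^{2\pi i/d}$; for $F\in\mathbb Z[x]$, $M_{15}(F)=\prod_{j=1}^{15}F(\omega_{15}^j)$ and $N_3(F)=F(\omega_3)F(\omega_3^2)$; $\Phi_d$ is the $d$-th cyclotomic polynomial. *)

theory Defs
  imports Complex_Main "HOL-Computational_Algebra.Computational_Algebra"
    "HOL-Number_Theory.Cong"
begin

definition omega :: "nat \<Rightarrow> complex" where
  "omega d = exp (2 * of_real pi * \<i> / of_nat d)"

abbreviation cpoly :: "int poly \<Rightarrow> complex poly" where
  "cpoly \<equiv> map_poly of_int"

definition M15 :: "int poly \<Rightarrow> complex" where
  "M15 F = (\<Prod>j = 1..15. poly (cpoly F) (omega 15 ^ j))"

definition N3 :: "int poly \<Rightarrow> complex" where
  "N3 F = poly (cpoly F) (omega 3) * poly (cpoly F) (omega 3 ^ 2)"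

abbreviation X :: "int poly" where
  "X \<equiv> [:0, 1:]"

definition cyclotomic_complex :: "nat \<Rightarrow> complex poly" where
  "cyclotomic_complex d = (\<Prod>k \<in> {k \<in> {1..d}. coprime k d}. [:- (omega d ^ k), 1:])"

text \<open>The description below is proper for every \<open>d\<close>: see \<open>cpoly_cyclotomic\<close>.\<close>

definition cyclotomic :: "nat \<Rightarrow> int poly" where
  "cyclotomic d = (THE P. cpoly P = cyclotomic_complex d)"

lemma cpoly_mult: "cpoly (p * q) = cpoly p * cpoly q"
  by (rule poly_eqI) (simp add: coeff_map_poly coeff_mult)

lemma cpoly_add: "cpoly (p + q) = cpoly p + cpoly q"
  by (rule poly_eqI) (simp add: coeff_map_poly)

lemma cpoly_prod: "cpoly (prod f A) = (\<Prod>a\<in>A. cpoly (f a))"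
  by (induction A rule: infinite_finite_induct) (simp_all add: cpoly_mult)

lemma cpoly_inj: "cpoly p = cpoly q \<Longrightarrow> p = q"
  by (metis (mono_tags) coeff_map_poly of_int_0 of_int_eq_iff poly_eqI)

lemma degree_cpoly: "degree (cpoly p) = degree p"
  by (rule degree_map_poly) simp_all

lemma omega_power: "omega d ^ k = exp (2 * of_real pi * \<i> * of_nat k / of_nat d)"
  by (simp add: omega_def flip: exp_of_nat_mult) (simp add: mult_ac)

lemma omega_gcd:
  assumes "n > 0" "k > 0"
  shows "omega (n div gcd k n) ^ (k div gcd k n) = omega n ^ k"
proof -
  define g where "g = gcd k n"
  have g: "g > 0" "g dvd k" "g dvd n" using assms by (auto simp: g_def)
  obtain a b where "k = g * a" "n = g * b" using g(2,3) by (auto elim!: dvdE)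
  thus ?thesis using g(1) unfolding g_def[symmetric] omega_power by (simp add: mult.assoc)
qed

lemma monom_minus_one_eq_prod_linear:
  assumes n: "n > 0"
  shows "monom 1 n - 1 = (\<Prod>k=1..n. [:- (omega n ^ k), 1:])"
proof -
  let ?P = "monom 1 n - 1 :: complex poly" and ?Q = "\<Prod>k=1..n. [:- (omega n ^ k), 1:]"
  have omega_n: "omega n ^ n = 1" using n by (simp add: omega_power)
  have inj: "inj_on (\<lambda>k. omega n ^ k) {1..n}"
  proof -
    have bij: "inj_on (\<lambda>k. cis (2 * pi * real k / real n)) {..<n}"
      using bij_betw_roots_unity[OF n] by (rule bij_betw_imp_inj_on)
    have cis: "omega n ^ k = cis (2 * pi * real k / real n)" for k
      by (simp add: omega_power cis_conv_exp mult_ac)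
    have *: "omega n ^ (k mod n) = omega n ^ k" for k
      by (metis mod_div_mult_eq mult.commute mult.right_neutral omega_n power_add power_mult power_one)
    show ?thesis
    proof (rule inj_onI)
      fix a b assume ab: "a \<in> {1..n}" "b \<in> {1..n}" "omega n ^ a = omega n ^ b"
      hence "omega n ^ (a mod n) = omega n ^ (b mod n)" by (simp add: *)
      hence "a mod n = b mod n"
        using inj_onD[OF bij, of "a mod n" "b mod n"] n by (simp add: cis)
      thus "a = b" using ab(1,2)
        by (cases "a = n"; cases "b = n") auto
    qed
  qed
  have degQ: "degree ?Q = n"
    by (subst degree_prod_eq_sum_degree) auto
  have lcQ: "coeff ?Q n = 1"
    using degQ lead_coeff_prod[of "\<lambda>k. [:- (omega n ^ k), 1:]" "{1..n}"] by simp
  have "?P - ?Q = 0"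
  proof (rule ccontr)
    assume ne: "?P - ?Q \<noteq> 0"
    have "degree (?P - ?Q) \<le> n"
      by (intro degree_diff_le degree_monom_le) (use degQ in auto)
    moreover have "coeff (?P - ?Q) n = 0" using lcQ n by simp
    ultimately have deg: "degree (?P - ?Q) < n"
      using ne by (metis le_neq_implies_less leading_coeff_0_iff)
    have "(\<lambda>k. omega n ^ k) ` {1..n} \<subseteq> {z. poly (?P - ?Q) z = 0}"
    proof safe
      fix k assume k: "k \<in> {1..n}"
      have "(omega n ^ k) ^ n = 1"
        by (metis omega_n power_mult mult.commute power_one)
      moreover have "poly ?Q (omega n ^ k) = 0"
        using k by (auto simp: poly_prod)
      ultimately show "poly (?P - ?Q) (omega n ^ k) = 0"
        by (simp add: poly_monom)
    qed
    hence "card ((\<lambda>k. omega n ^ k) ` {1..n}) \<le> card {z. poly (?P - ?Q) z = 0}"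
      by (rule card_mono[OF poly_roots_finite[OF ne]])
    also have "\<dots> \<le> degree (?P - ?Q)" by (rule card_poly_roots_bound[OF ne])
    finally show False using deg card_image[OF inj] by simp
  qed
  thus ?thesis by simp
qed

lemma prod_cyclotomic_complex:
  assumes n: "n > 0"
  shows "(\<Prod>d | d dvd n. cyclotomic_complex d) = monom 1 n - 1"
proof -
  have fin: "finite {d. d dvd n}" using n by simp
  have "(\<Prod>k=1..n. [:- (omega n ^ k), 1:]) =
        (\<Prod>(d,k) \<in> (SIGMA d:{d. d dvd n}. {k \<in> {1..d}. coprime k d}). [:- (omega d ^ k), 1:])"
  proof (rule prod.reindex_bij_witness[where
        i = "\<lambda>(d,k). k * (n div d)" and j = "\<lambda>k. (n div gcd k n, k div gcd k n)"], goal_cases)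
    case (1 k)
    obtain e where e: "n = gcd k n * e" by (meson dvdE gcd_dvd2)
    hence "e > 0" using n by (metis gr0I mult_0_right)
    hence "n div (n div gcd k n) = gcd k n"
      using n by (metis e gcd_pos_nat less_not_refl nonzero_mult_div_cancel_left nonzero_mult_div_cancel_right)
    thus ?case by simp
  next
    case (2 k)
    hence "k > 0" by simp
    hence "coprime (k div gcd k n) (n div gcd k n)" by (intro div_gcd_coprime) auto
    moreover have "n div gcd k n dvd n" by (metis dvd_div_mult_self dvd_triv_left gcd_dvd2)
    ultimately show ?case using 2 by (auto simp: div_le_mono div_greater_zero_iff intro!: Suc_leI gcd_le1_nat)
  next
    case (3 p)
    then obtain d k where p: "p = (d, k)" "d dvd n" "1 \<le> k" "k \<le> d" "coprime k d" by auto
    then obtain e where e: "n = d * e" by (elim dvdE)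
    have "e > 0" "d > 0" using n e by auto
    moreover have "gcd (k * e) (d * e) = e"
      using p(5) by (metis coprime_imp_gcd_eq_1 gcd_mult_distrib_nat mult.commute mult.right_neutral)
    ultimately show ?case using p(1) e by simp
  next
    case (4 p)
    then obtain d k where p: "p = (d, k)" "d dvd n" "1 \<le> k" "k \<le> d" "coprime k d" by auto
    then obtain e where e: "n = d * e" by (elim dvdE)
    have "e > 0" "d > 0" using n e by auto
    thus ?case using p e by auto
  next
    case (5 k)
    thus ?case using omega_gcd[OF n, of k] by simp
  qed
  also have "\<dots> = (\<Prod>d | d dvd n. cyclotomic_complex d)"
    unfolding cyclotomic_complex_def by (rule prod.Sigma[symmetric]) (use fin in auto)
  finally show ?thesis using monom_minus_one_eq_prod_linear[OF n] by simp
qed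

lemma lead_coeff_cyclotomic_complex: "lead_coeff (cyclotomic_complex d) = 1"
  unfolding cyclotomic_complex_def by (simp add: lead_coeff_prod)

lemma monic_division_int:
  fixes Q F :: "int poly"
  assumes "lead_coeff Q = 1"
  shows "\<exists>q r. F = Q * q + r \<and> (r = 0 \<or> degree r < degree Q)"
proof -
  obtain q r where qr: "pseudo_divmod F Q = (q, r)" by fastforce
  have "Q \<noteq> 0" using assms by auto
  from pseudo_divmod[OF this qr] show ?thesis using assms by auto
qed

lemma ex_int_cyclotomic: "\<exists>P. cpoly P = cyclotomic_complex n"
proof (induction n rule: less_induct)
  case (less n)
  show ?case
  proof (cases "n = 0")
    case True
    thus ?thesis by (intro exI[of _ 1]) (simp add: cyclotomic_complex_def)
  next
    case False
    hence n: "n > 0" by simp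
    let ?D = "{d. d dvd n \<and> d \<noteq> n}"
    have finD: "finite ?D" by (rule finite_subset[of _ "{d. d dvd n}"]) (use n in auto)
    have "\<forall>d\<in>?D. \<exists>P. cpoly P = cyclotomic_complex d"
      using less n by (auto intro!: less dest: dvd_imp_le simp: le_neq_implies_less)
    then obtain P where P: "\<And>d. d \<in> ?D \<Longrightarrow> cpoly (P d) = cyclotomic_complex d" by metis
    define Q where "Q = prod P ?D"
    have cQ: "cpoly Q = (\<Prod>d\<in>?D. cyclotomic_complex d)"
      unfolding Q_def cpoly_prod using P by (intro prod.cong) auto
    have lc: "lead_coeff (cpoly Q) = 1"
      unfolding cQ by (simp add: lead_coeff_prod lead_coeff_cyclotomic_complex)
    hence lcQ: "lead_coeff Q = 1" by (simp add: degree_cpoly coeff_map_poly)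
    have "{d. d dvd n} = insert n ?D" by auto
    hence eq: "monom 1 n - 1 = cpoly Q * cyclotomic_complex n"
      using prod_cyclotomic_complex[OF n] finD by (simp add: cQ mult.commute)
    obtain q r where qr: "monom 1 n + [:-1:] = Q * q + r" "r = 0 \<or> degree r < degree Q"
      using monic_division_int[OF lcQ] by blast
    have "cpoly (monom 1 n + [:-1:]) = monom 1 n - 1"
      by (rule poly_eqI) (simp add: coeff_map_poly coeff_pCons split: nat.split)
    hence "cpoly Q * cyclotomic_complex n = cpoly Q * cpoly q + cpoly r"
      using eq qr(1) by (metis cpoly_add cpoly_mult)
    hence r: "cpoly Q * (cyclotomic_complex n - cpoly q) = cpoly r"
      by (simp add: algebra_simps)
    have "cyclotomic_complex n - cpoly q = 0"
    proof (rule ccontr)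
      assume ne: "cyclotomic_complex n - cpoly q \<noteq> 0"
      have "cpoly Q \<noteq> 0" using lc by auto
      hence "cpoly r \<noteq> 0" and "degree (cpoly r) \<ge> degree (cpoly Q)"
        using ne unfolding r[symmetric] by (auto simp: degree_mult_eq)
      thus False using qr(2) by (auto simp: degree_cpoly)
    qed
    thus ?thesis by (intro exI[of _ q]) simp
  qed
qed

lemma cpoly_cyclotomic: "cpoly (cyclotomic d) = cyclotomic_complex d"
  unfolding cyclotomic_def
  by (rule theI') (use ex_int_cyclotomic cpoly_inj in metis)

end

theory Submission
  imports Defs "HOL-Number_Theory.Residue_Primitive_Roots" "HOL-Library.Discrete_Functions"
begin

text \<open>
  \<open>M15 F\<close> is \<open>F 1\<close> times the norms of \<open>F\<close> at primitive 3rd, 5th and 15th roots of unity. The term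
  containing \<open>\<Phi>\<^sub>5 \<Phi>\<^sub>1\<^sub>5\<close> vanishes at 1 and at the 5th and 15th roots, while \<open>\<Phi>\<^sub>5 \<Phi>\<^sub>1\<^sub>5 = 5\<close> at the
  primitive 3rd roots, so only the norm at the 3rd roots depends on the parameters, and it is the given one, up to a
  factor \<open>N3 (1 - X) = 3\<close> in the first polynomials. The other two norms are constants, computed along the towers of subgroups
  generated by 4 and 2 in the unit groups modulo 5 and modulo 15.

  For existence, a prime \<open>p \<equiv> 1 (mod 3)\<close> is the norm of an Eisenstein integer. The six units
  represent exactly the elements of norm 1 in the field with 25 elements, so an associate has any
  prescribed residue modulo 5 of the right norm. For the second polynomial the residue modulo
  \<open>\<omega> - 1\<close> must also match; if it has the wrong sign, passing to the conjugate and adjusting by a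
  unit restores the residue modulo 5 and flips that sign.
\<close>

section \<open>Explicit cyclotomic polynomials of orders 1, 3, 5 and 15\<close>

lemma cpoly_diff: "cpoly (p - q) = cpoly p - cpoly q"
  by (rule poly_eqI) (simp add: coeff_map_poly)

lemma cpoly_power: "cpoly (p ^ n) = cpoly p ^ n"
  by (induction n) (simp_all add: cpoly_mult)

lemma cpoly_numeral: "cpoly (numeral n) = numeral n"
  by (simp add: numeral_poly map_poly_pCons)

lemma cpoly_of_int: "cpoly (of_int k) = of_int k"
  by (simp add: of_int_poly map_poly_pCons)

lemma cpoly_X: "cpoly X = [:0, 1:]"
  by (simp add: map_poly_pCons)

lemma cpoly_1: "cpoly 1 = 1"
  by simp

lemmas cpoly_simps =
  cpoly_1 cpoly_add cpoly_mult cpoly_diff cpoly_power cpoly_numeral cpoly_of_int cpoly_X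

lemma prod_cyclotomic:
  assumes "n > 0"
  shows "(\<Prod>d | d dvd n. cyclotomic d) = X ^ n - 1"
proof (rule cpoly_inj)
  show "cpoly (\<Prod>d | d dvd n. cyclotomic d) = cpoly (X ^ n - 1)"
    using prod_cyclotomic_complex[OF assms]
    by (simp add: cpoly_prod cpoly_cyclotomic cpoly_simps monom_altdef)
qed

lemma cyclotomic_1: "cyclotomic 1 = X - 1"
  using prod_cyclotomic[of 1] by simp

lemma cyclotomic_prime:
  assumes "prime q"
  shows "cyclotomic q = (\<Sum>i<q. X ^ i)"
proof -
  have "q \<noteq> 1" "q > 0" using assms prime_gt_1_nat[of q] by auto
  moreover have "{d. d dvd q} = {1, q}" using assms by (auto simp: prime_nat_iff)
  ultimately have "(X - 1) * cyclotomic q = X ^ q - 1"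
    using prod_cyclotomic[of q] by (simp add: cyclotomic_1[unfolded One_nat_def])
  also have "\<dots> = (X - 1) * (\<Sum>i<q. X ^ i)" by (rule power_diff_1_eq)
  finally show ?thesis by (subst (asm) mult_cancel_left) (simp add: one_pCons)
qed

lemma cyclotomic_3: "cyclotomic 3 = 1 + X + X ^ 2"
  by (simp only: cyclotomic_prime[of 3, simplified]) (simp add: numeral_eq_Suc)

lemma cyclotomic_5: "cyclotomic 5 = 1 + X + X ^ 2 + X ^ 3 + X ^ 4"
  by (simp only: cyclotomic_prime[of 5, simplified]) (simp add: numeral_eq_Suc)

lemma cyclotomic_15: "cyclotomic 15 = 1 - X + X ^ 3 - X ^ 4 + X ^ 5 - X ^ 7 + X ^ 8"
proof -
  have "{d. d dvd 15} = {1, 3, 5, 15 :: nat}"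
  proof (intro equalityI subsetI)
    fix d :: nat assume d: "d \<in> {d. d dvd 15}"
    hence "d \<in> {..15}" by (auto dest: dvd_imp_le)
    hence "d \<in> {0, 1, 2, 3, 4, 5, 6, 7, 8, 9, 10, 11, 12, 13, 14, 15}"
      by (simp; presburger)
    thus "d \<in> {1, 3, 5, 15}" using d by (elim insertE) simp_all
  qed auto
  hence "(X - 1) * cyclotomic 3 * cyclotomic 5 * cyclotomic 15 = X ^ 15 - 1"
    using prod_cyclotomic[of 15] by (simp add: cyclotomic_1[unfolded One_nat_def] mult.assoc)
  also have "\<dots> = (X - 1) * cyclotomic 3 * cyclotomic 5 *
      (1 - X + X ^ 3 - X ^ 4 + X ^ 5 - X ^ 7 + X ^ 8)"
    unfolding cyclotomic_3 cyclotomic_5 by Groebner_Basis.algebra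
  finally show ?thesis
    by (subst (asm) mult_cancel_left)
      (simp add: cyclotomic_3 cyclotomic_5 one_pCons power2_eq_square power3_eq_cube power4_eq_xxxx)
qed

lemma cyclotomic_root:
  assumes "coprime k d" "1 \<le> k" "k \<le> d"
  shows "poly (cpoly (cyclotomic d)) (omega d ^ k) = 0"
  using assms by (auto simp: cpoly_cyclotomic cyclotomic_complex_def poly_prod)

section \<open>Norms at roots of unity of orders 3, 5 and 15\<close>

lemma omega_eq_omega_mult_power: "k > 0 \<Longrightarrow> omega d = omega (k * d) ^ k"
  by (simp add: omega_power) (simp add: omega_def)

lemma omega_power_self: "d > 0 \<Longrightarrow> omega d ^ d = 1"
  by (simp add: omega_power)

lemma omega_3_root:
  assumes "z \<in> {omega 3, omega 3 ^ 2}"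
  shows "1 + z + z ^ 2 = 0"
proof -
  have "coprime 2 (3 :: nat)" by (simp add: prime_imp_coprime)
  thus ?thesis
    using assms cyclotomic_root[of 1 3] cyclotomic_root[of 2 3]
    by (auto simp: cyclotomic_3 cpoly_simps)
qed

lemma N3_mult: "N3 (F * G) = N3 F * N3 G"
  by (simp add: N3_def cpoly_mult)

text \<open>Quantifying over all roots of \<open>1 + z + z ^ 2\<close> leaves a goal with a single
  polynomial hypothesis, suited to Groebner bases.\<close>

lemma N3_cong:
  assumes "\<And>z. 1 + z + z ^ 2 = 0 \<Longrightarrow> poly (cpoly F) z = poly (cpoly G) z"
  shows "N3 F = N3 G"
  using assms[OF omega_3_root, of "omega 3"] assms[OF omega_3_root, of "omega 3 ^ 2"]
  by (simp add: N3_def)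

lemma N3_linear:
  assumes "\<And>z. 1 + z + z ^ 2 = 0 \<Longrightarrow> poly (cpoly F) z = of_int a + of_int b * z"
  shows "N3 F = of_int (a\<^sup>2 - a * b + b\<^sup>2)"
proof -
  define w where "w = omega 3"
  have w: "1 + w + w ^ 2 = 0" "1 + w ^ 2 + (w ^ 2) ^ 2 = 0"
    unfolding w_def by (rule omega_3_root, simp)+
  have "N3 F = (of_int a + of_int b * w) * (of_int a + of_int b * w ^ 2)"
    using assms[OF w(1)] assms[OF w(2)] by (simp add: N3_def w_def)
  also have "\<dots> = of_int a ^ 2 - of_int a * of_int b + of_int b ^ 2"
    using w(1) by Groebner_Basis.algebra
  finally show ?thesis by simp
qed

lemma N3_one_minus_X: "N3 (1 - X) = 3"
  by (subst N3_linear[of _ 1 "-1"]) (simp_all add: cpoly_simps)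

text \<open>\<open>f\<close> and \<open>f'\<close> represent \<open>F\<close> at the 5th and 15th
  roots, \<open>g\<close> and \<open>g'\<close> are products over \<open>z\<close>,
  \<open>z ^ 4\<close>, and \<open>c\<close> and \<open>c'\<close> products over \<open>z\<close>,
  \<open>z ^ 2\<close>, \<open>z ^ 4\<close>, \<open>z ^ 8\<close>. Reducing after each stage keeps
  the polynomial identities small. The powers of 2 exhaust the units modulo 5 but have index 2
  modulo 15; the same \<open>c'\<close> serves both cosets, hence the square.\<close>

lemma M15_eq:
  fixes f g f' g' :: "complex \<Rightarrow> complex"
  assumes f: "\<And>z. 1 + z + z ^ 2 + z ^ 3 + z ^ 4 = 0 \<Longrightarrow> poly (cpoly F) z = f z"
    and g: "\<And>z. 1 + z + z ^ 2 + z ^ 3 + z ^ 4 = 0 \<Longrightarrow> f z * f (z ^ 4) = g z"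
    and c: "\<And>z. 1 + z + z ^ 2 + z ^ 3 + z ^ 4 = 0 \<Longrightarrow> g z * g (z ^ 2) = c"
    and f': "\<And>z. 1 - z + z ^ 3 - z ^ 4 + z ^ 5 - z ^ 7 + z ^ 8 = 0 \<Longrightarrow> poly (cpoly F) z = f' z"
    and g': "\<And>z. 1 - z + z ^ 3 - z ^ 4 + z ^ 5 - z ^ 7 + z ^ 8 = 0 \<Longrightarrow> f' z * f' (z ^ 4) = g' z"
    and c': "\<And>z. 1 - z + z ^ 3 - z ^ 4 + z ^ 5 - z ^ 7 + z ^ 8 = 0 \<Longrightarrow> g' z * g' (z ^ 2) = c'"
  shows "M15 F = poly (cpoly F) 1 * N3 F * c * c'\<^sup>2"
proof -
  define w where "w = omega 15"
  let ?P = "\<lambda>k. poly (cpoly F) (w ^ k)"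
  have w3: "omega 3 = w ^ 5" and w5: "omega 5 = w ^ 3"
    using omega_eq_omega_mult_power[of 5 3] omega_eq_omega_mult_power[of 3 5]
    by (simp_all add: w_def)
  have w15: "w ^ 15 = 1" by (simp add: w_def omega_power_self)
  have r5: "1 + z + z ^ 2 + z ^ 3 + z ^ 4 = 0" if "z = w ^ (3 * k)" "coprime k 5" "1 \<le> k" "k \<le> 5"
    for z k
    using cyclotomic_root[of k 5] that
    by (simp add: cyclotomic_5 cpoly_simps w5 power_mult)
  have r15: "1 - z + z ^ 3 - z ^ 4 + z ^ 5 - z ^ 7 + z ^ 8 = 0"
    if "z = w ^ k" "coprime k 15" "1 \<le> k" "k \<le> 15" for z k
    using cyclotomic_root[of k 15] that
    by (simp add: cyclotomic_15 cpoly_simps w_def)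
  have red: "w ^ n = w ^ (n mod 15)" for n
    by (metis w15 mod_div_mult_eq mult.commute mult.right_neutral power_add power_mult power_one)
  \<comment> \<open>Exponents are grouped by their gcd with 15 and paired as \<open>k\<close>,
    \<open>4 * k\<close> modulo 15. The units form the cosets 1, 4, 2, 8 and 7, 13, 14, 11 of the
    subgroup generated by 2.\<close>
  have "M15 F = (?P 15 * (?P 5 * ?P 10)) * ((?P 3 * ?P 12) * (?P 6 * ?P 9)) *
      (((?P 1 * ?P 4) * (?P 2 * ?P 8)) * ((?P 7 * ?P 13) * (?P 14 * ?P 11)))"
    unfolding M15_def w_def[symmetric] by (simp add: numeral_eq_Suc mult_ac)
  also have "?P 15 * (?P 5 * ?P 10) = poly (cpoly F) 1 * N3 F"
    by (simp add: w15 N3_def w3 flip: power_mult)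
  also have "?P 3 * ?P 12 * (?P 6 * ?P 9) = c"
  proof -
    have cop: "coprime k 5" if "k \<in> {1, 2, 3, 4 :: nat}" for k
      using that by (elim insertE emptyE) (simp_all add: coprime_iff_gcd_eq_1 gcd_non_0_nat)
    have root: "1 + w ^ (3 * k) + (w ^ (3 * k)) ^ 2 + (w ^ (3 * k)) ^ 3 + (w ^ (3 * k)) ^ 4 = 0"
      if "k \<in> {1, 2, 3, 4}" for k
    proof (rule r5[OF refl cop[OF that]])
      show "1 \<le> k" "k \<le> 5" using that by auto
    qed
    have pair: "?P (3 * k) * ?P (3 * l) = g (w ^ (3 * k))"
      if "(k, l) \<in> {(1, 4), (2, 3)}" for k l
    proof -
      have "w ^ (3 * l) = (w ^ (3 * k)) ^ 4"
        using that red[of 24] by (auto simp flip: power_mult)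
      moreover have "k \<in> {1, 2, 3, 4}" "l \<in> {1, 2, 3, 4}" using that by auto
      ultimately show ?thesis using f g root by metis
    qed
    have "g (w ^ (3 * 1)) * g ((w ^ (3 * 1)) ^ 2) = c"
      by (rule c, rule root) simp
    thus ?thesis using pair[of 1 4] pair[of 2 3] by (simp flip: power_mult)
  qed
  also have "?P 1 * ?P 4 * (?P 2 * ?P 8) * (?P 7 * ?P 13 * (?P 14 * ?P 11)) = c'\<^sup>2"
  proof -
    let ?U = "{1, 2, 4, 7, 8, 11, 13, 14 :: nat}"
    have cop: "coprime k 15" if "k \<in> ?U" for k
      using that by (elim insertE emptyE) (simp_all add: coprime_iff_gcd_eq_1 gcd_non_0_nat)
    have root: "1 - w ^ k + (w ^ k) ^ 3 - (w ^ k) ^ 4 + (w ^ k) ^ 5 - (w ^ k) ^ 7 + (w ^ k) ^ 8 = 0"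
      if "k \<in> ?U" for k
    proof (rule r15[OF refl cop[OF that]])
      show "1 \<le> k" "k \<le> 15" using that by auto
    qed
    have pair: "?P k * ?P l = g' (w ^ k)"
      if "(k, l) \<in> {(1, 4), (2, 8), (7, 13), (14, 11)}" for k l
    proof -
      \<comment> \<open>The last two pairs wrap around: 28 = 13 and 56 = 11 modulo 15.\<close>
      have "w ^ l = (w ^ k) ^ 4"
        using that red[of 28] red[of 56] by (auto simp flip: power_mult)
      moreover have "k \<in> ?U" "l \<in> ?U" using that by auto
      ultimately show ?thesis using f' g' root by metis
    qed
    have "g' (w ^ 1) * g' ((w ^ 1) ^ 2) = c'" "g' (w ^ 7) * g' ((w ^ 7) ^ 2) = c'"
      by (rule c', rule root, simp)+
    thus ?thesis using pair[of 1 4] pair[of 2 8] pair[of 7 13] pair[of 14 11]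
      by (simp add: power2_eq_square flip: power_mult power_add)
  qed
  finally show ?thesis by (simp add: mult_ac)
qed

section \<open>Evaluation of \<open>M15\<close> on the four families\<close>

lemma pcompose_cyclotomic_3: "pcompose (cyclotomic 3) (X ^ 3) = 1 + X ^ 3 + X ^ 6"
  by (simp add: cyclotomic_3 pcompose_add pcompose_mult power2_eq_square pcompose_pCons pcompose_1
      flip: power_add)

lemmas poly_cpoly_simps =
  cpoly_simps poly_add poly_mult poly_diff poly_power poly_1 poly_numeral
  poly_of_int poly_pCons poly_0 mult_zero_right mult_1_right add_0_left add_0_right
  pcompose_cyclotomic_3 cyclotomic_5 cyclotomic_15

text \<open>The factor 9 is the value 3 at 1 times \<open>N3 (1 - X)\<close>; the norms at the 5th
  and 15th roots are 1.\<close>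

lemma M15_p7_first:
  "M15 (1 - X + X ^ 3 * pcompose (cyclotomic 3) (X ^ 3)
      + (1 - X) * cyclotomic 5 * cyclotomic 15 * (of_int A * X + of_int B)) =
   9 * N3 (3 + X + 5 * (of_int A * X + of_int B))" (is "M15 ?F = 9 * N3 ?G")
proof -
  have "M15 ?F = poly (cpoly ?F) 1 * N3 ?F * 1 * 1\<^sup>2"
  \<comment> \<open>\<open>f\<close> and \<open>f'\<close> are remainders modulo the cyclotomic
    polynomials of orders 5 and 15. \<open>g\<close> and \<open>g'\<close> are written in terms
    invariant under \<open>z\<close> to \<open>z ^ 4\<close>, such as \<open>z ^ 2 + z ^ 3\<close>
    for order 5, and \<open>z + z ^ 4\<close> and \<open>z ^ 5\<close> for order 15.\<close>
  proof (rule M15_eq[where f = "\<lambda>z. - z - z ^ 2"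
        and g = "\<lambda>z. 1 - z ^ 2 - z ^ 3"
        and f' = "\<lambda>z. - z + z ^ 2 + z ^ 7"
        and g' = "\<lambda>z. 1 + z + z ^ 4 + z ^ 5"])
    fix z :: complex
    assume z: "1 + z + z ^ 2 + z ^ 3 + z ^ 4 = 0"
    show "poly (cpoly ?F) z = - z - z ^ 2"
      unfolding poly_cpoly_simps using z by Groebner_Basis.algebra
    show "(- z - z ^ 2) * (- (z ^ 4) - (z ^ 4) ^ 2) = 1 - z ^ 2 - z ^ 3"
      using z by Groebner_Basis.algebra
    show "(1 - z ^ 2 - z ^ 3) * (1 - (z ^ 2) ^ 2 - (z ^ 2) ^ 3) = 1"
      using z by Groebner_Basis.algebra
  next
    fix z :: complex
    assume z: "1 - z + z ^ 3 - z ^ 4 + z ^ 5 - z ^ 7 + z ^ 8 = 0"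
    show "poly (cpoly ?F) z = - z + z ^ 2 + z ^ 7"
      unfolding poly_cpoly_simps using z by Groebner_Basis.algebra
    show "(- z + z ^ 2 + z ^ 7) * (- (z ^ 4) + (z ^ 4) ^ 2 + (z ^ 4) ^ 7) = 1 + z + z ^ 4 + z ^ 5"
      using z by Groebner_Basis.algebra
    show "(1 + z + z ^ 4 + z ^ 5) * (1 + z ^ 2 + (z ^ 2) ^ 4 + (z ^ 2) ^ 5) = 1"
      using z by Groebner_Basis.algebra
  qed
  \<comment> \<open>At a primitive cube root \<omega> the parameter-free part is 4 - \<omega> = (1 -
    \<omega>)(3 + \<omega>).\<close>
  moreover have "N3 ?F = N3 ((1 - X) * ?G)"
    by (rule N3_cong, unfold poly_cpoly_simps) Groebner_Basis.algebra
  moreover have "poly (cpoly ?F) 1 = 3"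
    unfolding poly_cpoly_simps by simp
  ultimately show ?thesis by (simp add: N3_mult N3_one_minus_X)
qed

text \<open>The factor 25 is the value 5 at 1 times the norm 5 at the 5th roots. At the 15th roots
  each coset contributes -1, so that norm is 1.\<close>

lemma M15_p7_second:
  "M15 (1 - X ^ 2 + X ^ 4 + X ^ 9 + X ^ 10 + X ^ 13 + X ^ 14
      + (X - 1) * cyclotomic 5 * cyclotomic 15 * (of_int C * X + of_int D)) =
   25 * N3 (2 + 3 * X + 5 * (X - 1) * (of_int C * X + of_int D))" (is "M15 ?F = 25 * N3 ?G")
proof -
  have "M15 ?F = poly (cpoly ?F) 1 * N3 ?F * 5 * (-1)\<^sup>2"
  proof (rule M15_eq[where f = "\<lambda>z. - (1) - 3 * z - 4 * z ^ 2 - 2 * z ^ 3"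
        and g = "\<lambda>z. 7 - 11 * z ^ 2 - 11 * z ^ 3"
        and f' = "\<lambda>z. 1 - z - z ^ 2 - z ^ 4 - z ^ 7"
        and g' = "\<lambda>z. - z - z ^ 4"])
    fix z :: complex
    assume z: "1 + z + z ^ 2 + z ^ 3 + z ^ 4 = 0"
    show "poly (cpoly ?F) z = - (1) - 3 * z - 4 * z ^ 2 - 2 * z ^ 3"
      unfolding poly_cpoly_simps using z by Groebner_Basis.algebra
    show "(- (1) - 3 * z - 4 * z ^ 2 - 2 * z ^ 3) * (- (1) - 3 * (z ^ 4) - 4 * (z ^ 4) ^ 2 - 2 * (z ^ 4) ^ 3) = 7 - 11 * z ^ 2 - 11 * z ^ 3"
      using z by Groebner_Basis.algebra
    show "(7 - 11 * z ^ 2 - 11 * z ^ 3) * (7 - 11 * (z ^ 2) ^ 2 - 11 * (z ^ 2) ^ 3) = 5"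
      using z by Groebner_Basis.algebra
  next
    fix z :: complex
    assume z: "1 - z + z ^ 3 - z ^ 4 + z ^ 5 - z ^ 7 + z ^ 8 = 0"
    show "poly (cpoly ?F) z = 1 - z - z ^ 2 - z ^ 4 - z ^ 7"
      unfolding poly_cpoly_simps using z by Groebner_Basis.algebra
    show "(1 - z - z ^ 2 - z ^ 4 - z ^ 7) * (1 - (z ^ 4) - (z ^ 4) ^ 2 - (z ^ 4) ^ 4 - (z ^ 4) ^ 7) = - z - z ^ 4"
      using z by Groebner_Basis.algebra
    show "(- z - z ^ 4) * (- ((z ^ 2)) - (z ^ 2) ^ 4) = -1"
      using z by Groebner_Basis.algebra
  qed
  moreover have "N3 ?F = N3 ?G"
    by (rule N3_cong, unfold poly_cpoly_simps) Groebner_Basis.algebra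
  moreover have "poly (cpoly ?F) 1 = 5"
    unfolding poly_cpoly_simps by simp
  ultimately show ?thesis by simp
qed

lemma M15_p13_first:
  "M15 (1 - X ^ 5 - X ^ 11 + X ^ 12 + X ^ 3 * pcompose (cyclotomic 3) (X ^ 3)
      + (1 - X) * cyclotomic 5 * cyclotomic 15 * (of_int A * X + of_int B)) =
   9 * N3 (4 + 3 * X + 5 * (of_int A * X + of_int B))" (is "M15 ?F = 9 * N3 ?G")
proof -
  have "M15 ?F = poly (cpoly ?F) 1 * N3 ?F * 1 * 1\<^sup>2"
  proof (rule M15_eq[where f = "\<lambda>z. - (1) - z"
        and g = "\<lambda>z. 1 - z ^ 2 - z ^ 3"
        and f' = "\<lambda>z. z - z ^ 5 + z ^ 6"
        and g' = "\<lambda>z. - (2) + z + z ^ 4 - 2 * z ^ 5"])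
    fix z :: complex
    assume z: "1 + z + z ^ 2 + z ^ 3 + z ^ 4 = 0"
    show "poly (cpoly ?F) z = - (1) - z"
      unfolding poly_cpoly_simps using z by Groebner_Basis.algebra
    show "(- (1) - z) * (- (1) - (z ^ 4)) = 1 - z ^ 2 - z ^ 3"
      using z by Groebner_Basis.algebra
    show "(1 - z ^ 2 - z ^ 3) * (1 - (z ^ 2) ^ 2 - (z ^ 2) ^ 3) = 1"
      using z by Groebner_Basis.algebra
  next
    fix z :: complex
    assume z: "1 - z + z ^ 3 - z ^ 4 + z ^ 5 - z ^ 7 + z ^ 8 = 0"
    show "poly (cpoly ?F) z = z - z ^ 5 + z ^ 6"
      unfolding poly_cpoly_simps using z by Groebner_Basis.algebra
    show "(z - z ^ 5 + z ^ 6) * ((z ^ 4) - (z ^ 4) ^ 5 + (z ^ 4) ^ 6) = - (2) + z + z ^ 4 - 2 * z ^ 5"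
      using z by Groebner_Basis.algebra
    show "(- (2) + z + z ^ 4 - 2 * z ^ 5) * (- (2) + (z ^ 2) + (z ^ 2) ^ 4 - 2 * (z ^ 2) ^ 5) = 1"
      using z by Groebner_Basis.algebra
  qed
  moreover have "N3 ?F = N3 ((1 - X) * ?G)"
    by (rule N3_cong, unfold poly_cpoly_simps) Groebner_Basis.algebra
  moreover have "poly (cpoly ?F) 1 = 3"
    unfolding poly_cpoly_simps by simp
  ultimately show ?thesis by (simp add: N3_mult N3_one_minus_X)
qed

lemma M15_p13_second:
  "M15 (1 + X ^ 3 + X ^ 6 + X ^ 9 + X ^ 14
      + (X - 1) * cyclotomic 5 * cyclotomic 15 * (of_int C * X + of_int D)) =
   25 * N3 (3 - X + 5 * (X - 1) * (of_int C * X + of_int D))" (is "M15 ?F = 25 * N3 ?G")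
proof -
  have "M15 ?F = poly (cpoly ?F) 1 * N3 ?F * 5 * (-1)\<^sup>2"
  proof (rule M15_eq[where f = "\<lambda>z. - (1) - z - 2 * z ^ 2 - z ^ 3"
        and g = "\<lambda>z. 2 - z ^ 2 - z ^ 3"
        and f' = "\<lambda>z. 1 + z ^ 3 - z ^ 4 + z ^ 6"
        and g' = "\<lambda>z. 1 - z - z ^ 2 + z ^ 3 - z ^ 4 - z ^ 7"])
    fix z :: complex
    assume z: "1 + z + z ^ 2 + z ^ 3 + z ^ 4 = 0"
    show "poly (cpoly ?F) z = - (1) - z - 2 * z ^ 2 - z ^ 3"
      unfolding poly_cpoly_simps using z by Groebner_Basis.algebra
    show "(- (1) - z - 2 * z ^ 2 - z ^ 3) * (- (1) - (z ^ 4) - 2 * (z ^ 4) ^ 2 - (z ^ 4) ^ 3) = 2 - z ^ 2 - z ^ 3"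
      using z by Groebner_Basis.algebra
    show "(2 - z ^ 2 - z ^ 3) * (2 - (z ^ 2) ^ 2 - (z ^ 2) ^ 3) = 5"
      using z by Groebner_Basis.algebra
  next
    fix z :: complex
    assume z: "1 - z + z ^ 3 - z ^ 4 + z ^ 5 - z ^ 7 + z ^ 8 = 0"
    show "poly (cpoly ?F) z = 1 + z ^ 3 - z ^ 4 + z ^ 6"
      unfolding poly_cpoly_simps using z by Groebner_Basis.algebra
    show "(1 + z ^ 3 - z ^ 4 + z ^ 6) * (1 + (z ^ 4) ^ 3 - (z ^ 4) ^ 4 + (z ^ 4) ^ 6) = 1 - z - z ^ 2 + z ^ 3 - z ^ 4 - z ^ 7"
      using z by Groebner_Basis.algebra
    show "(1 - z - z ^ 2 + z ^ 3 - z ^ 4 - z ^ 7) * (1 - (z ^ 2) - (z ^ 2) ^ 2 + (z ^ 2) ^ 3 - (z ^ 2) ^ 4 - (z ^ 2) ^ 7) = -1"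
      using z by Groebner_Basis.algebra
  qed
  moreover have "N3 ?F = N3 ?G"
    by (rule N3_cong, unfold poly_cpoly_simps) Groebner_Basis.algebra
  moreover have "poly (cpoly ?F) 1 = 5"
    unfolding poly_cpoly_simps by simp
  ultimately show ?thesis by simp
qed

section \<open>Primes congruent to 1 modulo 3 as Eisenstein norms\<close>

text \<open>As 3 divides \<open>p - 1\<close>, there are elements of order 3 modulo
  \<open>p\<close>; for such an element, \<open>p\<close> divides the cofactor of
  \<open>x - 1\<close> in \<open>x ^ 3 - 1\<close>.\<close>

lemma primitive_cube_root_mod_prime:
  fixes p :: nat
  assumes "prime p" "[p = 1] (mod 3)"
  obtains s :: int where "int p dvd s\<^sup>2 + s + 1"
proof -
  have p1: "p > 1" using assms(1) by (rule prime_gt_1_nat)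
  have "3 dvd p - 1" using assms(2) p1 by (simp add: cong_def) presburger
  hence "card {x \<in> totatives p. ord p x = 3} = 2"
    using prime_card_elements_with_ord_eq_totient[OF p1 assms(1), of 3]
    by (simp add: totient_prime)
  then obtain x where x: "ord p x = 3"
    by (metis (mono_tags, lifting) card.empty empty_Collect_eq zero_neq_numeral)
  have "[x ^ 3 = 1] (mod p)" "\<not> [x ^ 1 = 1] (mod p)"
    using ord_works[of x p] x by (force, force)
  hence "[int x ^ 3 = 1] (mod int p)" "\<not> [int x = 1] (mod int p)"
    by (metis cong_int_iff of_nat_1 of_nat_power, metis cong_int_iff of_nat_1 power_one_right)
  moreover have "int x ^ 3 - 1 = (int x - 1) * ((int x)\<^sup>2 + int x + 1)"
    by Groebner_Basis.algebra
  ultimately have "int p dvd (int x)\<^sup>2 + int x + 1"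
    using assms(1) by (metis cong_iff_dvd_diff prime_dvd_multD prime_nat_int_transfer)
  thus ?thesis by (rule that)
qed

text \<open>Pigeonhole on \<open>i - s j\<close> modulo \<open>p\<close>, with \<open>0 \<le> i, j \<le> \<lfloor>\<surd>p\<rfloor>\<close>.\<close>

lemma thue_lemma:
  fixes p :: nat and s :: int
  assumes "prime p"
  obtains a b :: int where "(a, b) \<noteq> (0, 0)" "a\<^sup>2 < int p" "b\<^sup>2 < int p" "int p dvd a - s * b"
proof -
  define m where "m = floor_sqrt p"
  have p0: "p > 0" using assms prime_gt_0_nat by blast
  have m1: "m ^ 2 \<le> p" "p < (Suc m) ^ 2"
    unfolding m_def using Suc_floor_sqrt_power2_gt floor_sqrt_power2_le by auto
  have "m ^ 2 \<noteq> p" using assms prime_power_iff[of m 2] by (metis numeral_eq_one_iff semiring_norm(85))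
  hence m2: "m ^ 2 < p" using m1 by simp
  let ?A = "{0..int m} \<times> {0..int m}" and ?f = "\<lambda>(i, j). (i - s * j) mod int p"
  have "?f ` ?A \<subseteq> {0..<int p}" using p0 by auto
  hence "card (?f ` ?A) \<le> card {0..<int p}" by (intro card_mono) auto
  \<comment> \<open>The box has \<open>(m + 1) ^ 2 > p\<close> points for at most \<open>p\<close>
    residues.\<close>
  hence "card (?f ` ?A) < card ?A"
    using m1(2) by (simp add: power2_eq_square nat_add_distrib)
  hence "\<not> inj_on ?f ?A" by (rule pigeonhole)
  then obtain i j i' j' where *: "i \<in> {0..int m}" "j \<in> {0..int m}" "i' \<in> {0..int m}"
    "j' \<in> {0..int m}" "(i, j) \<noteq> (i', j')" "(i - s * j) mod int p = (i' - s * j') mod int p"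
    by (auto simp: inj_on_def)
  have sq: "x\<^sup>2 < int p" if "\<bar>x\<bar> \<le> int m" for x
  proof -
    have "x\<^sup>2 \<le> (int m)\<^sup>2" using that by (metis abs_le_square_iff abs_of_nat)
    also have "\<dots> < int p" using m2 by (metis of_nat_less_iff of_nat_power)
    finally show ?thesis .
  qed
  show ?thesis
  proof (rule that[of "i - i'" "j - j'"])
    show "int p dvd i - i' - s * (j - j')"
      using *(6) by (simp add: mod_eq_dvd_iff algebra_simps)
  qed (use * in \<open>auto intro!: sq\<close>)
qed

text \<open>For \<open>a\<close> congruent to \<open>s * b\<close>, the form
  \<open>a ^ 2 + a * b + b ^ 2\<close> is a multiple of \<open>p\<close>. Thue's bounds put it
  strictly between 0 and \<open>3 * p\<close>, and \<open>2 * p\<close> is impossible: an even value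
  forces \<open>a\<close> and \<open>b\<close> even, hence \<open>p = 2\<close>.\<close>

lemma prime_eq_eisenstein_norm:
  fixes p :: nat
  assumes "prime p" "[p = 1] (mod 3)"
  obtains a b :: int where "a\<^sup>2 - a * b + b\<^sup>2 = int p"
proof -
  obtain s where s: "int p dvd s\<^sup>2 + s + 1"
    using primitive_cube_root_mod_prime[OF assms] .
  obtain a b where ab: "(a, b) \<noteq> (0, 0)" "a\<^sup>2 < int p" "b\<^sup>2 < int p" "int p dvd a - s * b"
    using thue_lemma[OF assms(1)] .
  have "a\<^sup>2 + a * b + b\<^sup>2 = (a - s * b) * (a + s * b + b) + b\<^sup>2 * (s\<^sup>2 + s + 1)"
    by Groebner_Basis.algebra
  hence "int p dvd a\<^sup>2 + a * b + b\<^sup>2" using ab(4) s by simp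
  then obtain k where k: "a\<^sup>2 + a * b + b\<^sup>2 = int p * k" ..
  have p0: "int p > 0" using ab(2) by (smt (verit) zero_le_power2)
  have "2 * (a\<^sup>2 + a * b + b\<^sup>2) = a\<^sup>2 + b\<^sup>2 + (a + b)\<^sup>2"
    "2 * (a\<^sup>2 + a * b + b\<^sup>2) + (a - b)\<^sup>2 = 3 * a\<^sup>2 + 3 * b\<^sup>2"
    by Groebner_Basis.algebra+
  moreover have "a\<^sup>2 + b\<^sup>2 > 0" using ab(1) by (simp add: sum_power2_gt_zero_iff)
  ultimately have "0 < a\<^sup>2 + a * b + b\<^sup>2" "a\<^sup>2 + a * b + b\<^sup>2 < 3 * int p"
    using ab(2,3) zero_le_power2[of "a + b"] zero_le_power2[of "a - b"]
    by (smt (verit))+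
  hence "int p * 0 < int p * k" "int p * k < int p * 3" unfolding k by (simp, linarith)
  hence "0 < k" "k < 3" using p0 by (simp_all only: mult_less_cancel_left_pos)
  moreover have "k \<noteq> 2"
  proof
    assume "k = 2"
    hence e: "a\<^sup>2 + a * b + b\<^sup>2 = int p * 2" using k by simp
    hence "even (a\<^sup>2 + a * b + b\<^sup>2)" by simp
    hence "even a" "even b" by auto
    then obtain c d where "a = 2 * c" "b = 2 * d" by (auto elim!: evenE)
    hence "int p = 2 * (c\<^sup>2 + c * d + d\<^sup>2)" using e by (simp add: power2_eq_square algebra_simps)
    hence "even p" by (metis dvd_triv_left even_of_nat)
    hence "p = 2" using assms(1) by (metis primes_dvd_imp_eq two_is_prime_nat)
    thus False using assms(2) by (simp add: cong_def)
  qed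
  ultimately have "k = 1" by linarith
  hence "a\<^sup>2 - a * (- b) + (- b)\<^sup>2 = int p" using k by simp
  thus ?thesis by (rule that)
qed

section \<open>Prescribing residues modulo 5 and modulo \<omega> - 1\<close>

text \<open>5 is inert in the Eisenstein integers, so each nonzero norm class modulo 5 is one orbit
  of the six units. The two targets needed are checked on all 25 residue pairs.\<close>

lemma eisenstein_associate_mod_5:
  fixes a b c d :: int
  assumes norm: "(a\<^sup>2 - a * b + b\<^sup>2) mod 5 = (c\<^sup>2 - c * d + d\<^sup>2) mod 5"
    and cd: "(c, d) \<in> {(3, 1), (4, 3)}"
  obtains a' b' where "a'\<^sup>2 - a' * b' + b'\<^sup>2 = a\<^sup>2 - a * b + b\<^sup>2" "a' mod 5 = c" "b' mod 5 = d"
proof -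
  have "[(a mod 5)\<^sup>2 - (a mod 5) * (b mod 5) + (b mod 5)\<^sup>2 = a\<^sup>2 - a * b + b\<^sup>2] (mod 5)"
    by (intro cong_add cong_diff cong_mult cong_pow) (simp_all add: cong_def)
  hence *: "((a mod 5)\<^sup>2 - (a mod 5) * (b mod 5) + (b mod 5)\<^sup>2) mod 5 = (c\<^sup>2 - c * d + d\<^sup>2) mod 5"
    using norm by (simp only: cong_def)
  have mem: "a mod 5 \<in> {0, 1, 2, 3, 4}" "b mod 5 \<in> {0, 1, 2, 3, 4}" by auto
  \<comment> \<open>the six pairs are the multiples of \<open>r + s \<omega>\<close> by the units \<open>\<plusminus>1\<close>, \<open>\<plusminus>\<omega>\<close>, \<open>\<plusminus>\<omega>\<^sup>2\<close>\<close>
  have "\<exists>(a', b') \<in> {(r, s), (- r, - s), (- s, r - s), (s, s - r), (s - r, - r), (r - s, r)}.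
      a' mod 5 = c \<and> b' mod 5 = d"
    if "(r\<^sup>2 - r * s + s\<^sup>2) mod 5 = (c\<^sup>2 - c * d + d\<^sup>2) mod 5"
      "r \<in> {0, 1, 2, 3, 4}" "s \<in> {0, 1, 2, 3, 4}" for r s
    using that cd by (elim insertE emptyE) simp_all
  from this[of "a mod 5" "b mod 5"]
  have "\<exists>(a', b') \<in> {(a, b), (- a, - b), (- b, a - b), (b, b - a), (b - a, - a), (a - b, a)}.
      a' mod 5 = c \<and> b' mod 5 = d"
    using * mem by (simp add: mod_simps)
  then obtain a' b' where "(a', b') \<in> {(a, b), (- a, - b), (- b, a - b), (b, b - a), (b - a, - a), (a - b, a)}"
    "a' mod 5 = c" "b' mod 5 = d" by blast
  thus ?thesis by (intro that[of a' b']) (auto simp: power2_eq_square algebra_simps)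
qed

text \<open>Modulo \<omega> - 1, which lies above 3, \<open>a\<close> + \<open>b\<close> \<omega>
  reduces to \<open>a + b\<close>, and its norm is \<open>(a + b) ^ 2\<close> modulo 3.\<close>

lemma eisenstein_norm_not_dvd_3:
  fixes a b :: int
  assumes "\<not> 3 dvd a\<^sup>2 - a * b + b\<^sup>2"
  shows "(a + b) mod 3 = 1 \<or> (a + b) mod 3 = 2"
proof -
  have "a\<^sup>2 - a * b + b\<^sup>2 = (a + b) * (a + b) - 3 * (a * b)" by (simp add: power2_eq_square algebra_simps)
  hence "\<not> 3 dvd a + b" using assms by (metis dvd_diff dvd_mult dvd_triv_left)
  thus ?thesis by presburger
qed

lemma prime_eq_eisenstein_norm_mod_5:
  fixes p :: nat and c d :: int
  assumes "prime p" "[p = 1] (mod 3)" "[int p = c\<^sup>2 - c * d + d\<^sup>2] (mod 5)"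
    and "(c, d) \<in> {(3, 1), (4, 3)}"
  obtains a b :: int where "a\<^sup>2 - a * b + b\<^sup>2 = int p" "a mod 5 = c" "b mod 5 = d"
proof -
  obtain a b where ab: "a\<^sup>2 - a * b + b\<^sup>2 = int p"
    using prime_eq_eisenstein_norm[OF assms(1,2)] .
  have "(a\<^sup>2 - a * b + b\<^sup>2) mod 5 = (c\<^sup>2 - c * d + d\<^sup>2) mod 5"
    using assms(3) by (simp only: ab cong_def)
  from eisenstein_associate_mod_5[OF this assms(4)] obtain a' b' where
    "a'\<^sup>2 - a' * b' + b'\<^sup>2 = a\<^sup>2 - a * b + b\<^sup>2" "a' mod 5 = c" "b' mod 5 = d" .
  with ab show ?thesis by (intro that) auto
qed

lemma N3_affine: "N3 (of_int c + of_int d * X + 5 * (of_int A * X + of_int B)) =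
  of_int ((c + 5 * B)\<^sup>2 - (c + 5 * B) * (d + 5 * A) + (d + 5 * A)\<^sup>2)"
  by (rule N3_linear, unfold poly_cpoly_simps) (simp add: algebra_simps)

lemma N3_affine_ramified: "N3 (of_int c + of_int d * X + 5 * (X - 1) * (of_int C * X + of_int D)) =
  of_int ((c - 5 * (C + D))\<^sup>2 - (c - 5 * (C + D)) * (d + 5 * (D - 2 * C)) + (d + 5 * (D - 2 * C))\<^sup>2)"
proof (rule N3_linear)
  fix z :: complex assume z: "1 + z + z ^ 2 = 0"
  have "poly (cpoly (of_int c + of_int d * X + 5 * (X - 1) * (of_int C * X + of_int D))) z =
      of_int c + of_int d * z + 5 * (z - 1) * (of_int C * z + of_int D)"
    unfolding poly_cpoly_simps by simp
  also have "\<dots> = of_int c - 5 * (of_int C + of_int D) + (of_int d + 5 * (of_int D - 2 * of_int C)) * z"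
    using z by Groebner_Basis.algebra
  finally show "poly (cpoly (of_int c + of_int d * X + 5 * (X - 1) * (of_int C * X + of_int D))) z =
      of_int (c - 5 * (C + D)) + of_int (d + 5 * (D - 2 * C)) * z"
    by simp
qed

lemma exists_N3_affine:
  fixes a b c d :: int
  assumes "a mod 5 = c mod 5" "b mod 5 = d mod 5" "a\<^sup>2 - a * b + b\<^sup>2 = n"
  shows "\<exists>A B. N3 (of_int c + of_int d * X + 5 * (of_int A * X + of_int B)) = of_int n"
proof -
  obtain A B where "b = d + 5 * A" "a = c + 5 * B"
    using assms(1,2) by (metis mod_eqE)
  thus ?thesis using assms(3) unfolding N3_affine by blast
qed

text \<open>The multiples of \<omega> - 1 are the \<open>s\<close> + \<open>t\<close> \<omega> with
  3 dividing \<open>s + t\<close>; this is the source of the congruence modulo 3.\<close>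

lemma exists_N3_affine_ramified:
  fixes a b c d :: int
  assumes "a mod 5 = c mod 5" "b mod 5 = d mod 5" "(a + b) mod 3 = (c + d) mod 3"
    and "a\<^sup>2 - a * b + b\<^sup>2 = n"
  shows "\<exists>C D. N3 (of_int c + of_int d * X + 5 * (X - 1) * (of_int C * X + of_int D)) = of_int n"
proof -
  obtain s t where st: "a = c + 5 * s" "b = d + 5 * t"
    using assms(1,2) by (metis mod_eqE)
  have "3 dvd s + t" using assms(3) unfolding st by presburger
  then obtain k where "s + t = 3 * k" ..
  \<comment> \<open>Solving \<open>s = - (C + D)\<close> and \<open>t = D - 2 * C\<close> gives
    \<open>C = - k\<close> and \<open>D = k - s\<close>.\<close>
  hence "a = c - 5 * (- k + (k - s))" "b = d + 5 * ((k - s) - 2 * - k)"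
    using st by (simp_all add: algebra_simps)
  thus ?thesis using assms(4) unfolding N3_affine_ramified by blast
qed

theorem theorem5:
  fixes p :: nat
  assumes "prime p"
  shows
    "([p = 7] (mod 15) \<longrightarrow>
       (\<forall>A B C D :: int.
          N3 (3 + X + 5 * (of_int A * X + of_int B)) = of_nat p \<and>
          N3 (2 + 3 * X + 5 * (X - 1) * (of_int C * X + of_int D)) = of_nat p \<longrightarrow>
          M15 (1 - X + X ^ 3 * pcompose (cyclotomic 3) (X ^ 3)
               + (1 - X) * cyclotomic 5 * cyclotomic 15 * (of_int A * X + of_int B))
            = of_nat (3 ^ 2 * p) \<and>
          M15 (1 - X ^ 2 + X ^ 4 + X ^ 9 + X ^ 10 + X ^ 13 + X ^ 14
               + (X - 1) * cyclotomic 5 * cyclotomic 15 * (of_int C * X + of_int D))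
            = of_nat (5 ^ 2 * p)) \<and>
       (\<exists>A B C D :: int.
          N3 (3 + X + 5 * (of_int A * X + of_int B)) = of_nat p \<and>
          N3 (2 + 3 * X + 5 * (X - 1) * (of_int C * X + of_int D)) = of_nat p)) \<and>
     ([p = 13] (mod 15) \<longrightarrow>
       (\<forall>A B C D :: int.
          N3 (4 + 3 * X + 5 * (of_int A * X + of_int B)) = of_nat p \<and>
          N3 (3 - X + 5 * (X - 1) * (of_int C * X + of_int D)) = of_nat p \<longrightarrow>
          M15 (1 - X ^ 5 - X ^ 11 + X ^ 12 + X ^ 3 * pcompose (cyclotomic 3) (X ^ 3)
               + (1 - X) * cyclotomic 5 * cyclotomic 15 * (of_int A * X + of_int B))
            = of_nat (3 ^ 2 * p) \<and>
          M15 (1 + X ^ 3 + X ^ 6 + X ^ 9 + X ^ 14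
               + (X - 1) * cyclotomic 5 * cyclotomic 15 * (of_int C * X + of_int D))
            = of_nat (5 ^ 2 * p)) \<and>
       (\<exists>A B C D :: int.
          N3 (4 + 3 * X + 5 * (of_int A * X + of_int B)) = of_nat p \<and>
          N3 (3 - X + 5 * (X - 1) * (of_int C * X + of_int D)) = of_nat p))"
proof (intro conjI impI)
  assume cong: "[p = 7] (mod 15)"
  show "\<forall>A B C D :: int.
      N3 (3 + X + 5 * (of_int A * X + of_int B)) = of_nat p \<and>
      N3 (2 + 3 * X + 5 * (X - 1) * (of_int C * X + of_int D)) = of_nat p \<longrightarrow>
      M15 (1 - X + X ^ 3 * pcompose (cyclotomic 3) (X ^ 3)
      + (1 - X) * cyclotomic 5 * cyclotomic 15 * (of_int A * X + of_int B)) = of_nat (3 ^ 2 * p) \<and>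
      M15 (1 - X ^ 2 + X ^ 4 + X ^ 9 + X ^ 10 + X ^ 13 + X ^ 14
      + (X - 1) * cyclotomic 5 * cyclotomic 15 * (of_int C * X + of_int D)) = of_nat (5 ^ 2 * p)"
    unfolding M15_p7_first M15_p7_second by simp
  define q where "q = p div 15"
  have q: "p = 15 * q + 7"
    using cong mult_div_mod_eq[of 15 p] by (simp add: cong_def q_def)
  have p3: "[p = 1] (mod 3)" and "int p mod 5 = 2" and p: "\<not> 3 dvd int p"
    unfolding q cong_def by presburger+
  hence "[int p = 3\<^sup>2 - 3 * 1 + 1\<^sup>2] (mod 5)"
    by (simp add: cong_def)
  then obtain a b where ab: "a\<^sup>2 - a * b + b\<^sup>2 = int p" "a mod 5 = 3" "b mod 5 = 1"
    using prime_eq_eisenstein_norm_mod_5[OF assms p3, of 3 1] by blast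
  have "\<exists>A B. N3 (of_int 3 + of_int 1 * X + 5 * (of_int A * X + of_int B)) = of_int (int p)"
    using ab by (intro exists_N3_affine) auto
  moreover have "\<exists>C D. N3 (of_int 2 + of_int 3 * X + 5 * (X - 1) * (of_int C * X + of_int D)) = of_int (int p)"
  proof -
    \<comment> \<open>\<open>a' + b' \<omega> = - \<omega>\<^sup>2 (a + b \<omega>)\<close>\<close>
    define a' b' where "a' = a - b" and "b' = a"
    have ab': "a'\<^sup>2 - a' * b' + b'\<^sup>2 = int p" "a' mod 5 = 2" "b' mod 5 = 3"
      using ab by (simp_all add: a'_def b'_def power2_eq_square algebra_simps) presburger
    \<comment> \<open>The target 2 + 3 \<omega> has coefficient sum 5, so the residue wanted is
      2.\<close>
    consider "(a' + b') mod 3 = 2" | "(a' + b') mod 3 = 1"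
      using eisenstein_norm_not_dvd_3[of a' b'] p ab'(1) by auto
    thus ?thesis
    proof cases
      case 1
      thus ?thesis using ab' by (intro exists_N3_affine_ramified[of a' _ b']) auto
    next
      case 2
      \<comment> \<open>\<open>- b' - a' \<omega>\<close> is \<open>- \<omega>\<close> times the conjugate of \<open>a' + b' \<omega>\<close>\<close>
      have "(- b') mod 5 = 2" "(- a') mod 5 = 3"
        using ab'(2,3) by presburger+
      moreover have "(- b' + - a') mod 3 = 2"
        using 2 by presburger
      moreover have "(- b')\<^sup>2 - (- b') * (- a') + (- a')\<^sup>2 = int p"
        using ab'(1) by (simp add: algebra_simps)
      ultimately show ?thesis by (intro exists_N3_affine_ramified[of "- b'" _ "- a'"]) auto
    qed
  qed
  ultimately show "\<exists>A B C D :: int.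
      N3 (3 + X + 5 * (of_int A * X + of_int B)) = of_nat p \<and>
      N3 (2 + 3 * X + 5 * (X - 1) * (of_int C * X + of_int D)) = of_nat p"
    unfolding of_int_minus of_int_1 of_int_numeral of_int_of_nat_eq mult_minus1 mult_1
      add_uminus_conv_diff by blast
next
  assume cong: "[p = 13] (mod 15)"
  show "\<forall>A B C D :: int.
      N3 (4 + 3 * X + 5 * (of_int A * X + of_int B)) = of_nat p \<and>
      N3 (3 - X + 5 * (X - 1) * (of_int C * X + of_int D)) = of_nat p \<longrightarrow>
      M15 (1 - X ^ 5 - X ^ 11 + X ^ 12 + X ^ 3 * pcompose (cyclotomic 3) (X ^ 3)
      + (1 - X) * cyclotomic 5 * cyclotomic 15 * (of_int A * X + of_int B)) = of_nat (3 ^ 2 * p) \<and>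
      M15 (1 + X ^ 3 + X ^ 6 + X ^ 9 + X ^ 14
      + (X - 1) * cyclotomic 5 * cyclotomic 15 * (of_int C * X + of_int D)) = of_nat (5 ^ 2 * p)"
    unfolding M15_p13_first M15_p13_second by simp
  define q where "q = p div 15"
  have q: "p = 15 * q + 13"
    using cong mult_div_mod_eq[of 15 p] by (simp add: cong_def q_def)
  have p3: "[p = 1] (mod 3)" and "int p mod 5 = 3" and p: "\<not> 3 dvd int p"
    unfolding q cong_def by presburger+
  hence "[int p = 4\<^sup>2 - 4 * 3 + 3\<^sup>2] (mod 5)"
    by (simp add: cong_def)
  then obtain a b where ab: "a\<^sup>2 - a * b + b\<^sup>2 = int p" "a mod 5 = 4" "b mod 5 = 3"
    using prime_eq_eisenstein_norm_mod_5[OF assms p3, of 4 3] by blast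
  have "\<exists>A B. N3 (of_int 4 + of_int 3 * X + 5 * (of_int A * X + of_int B)) = of_int (int p)"
    using ab by (intro exists_N3_affine) auto
  moreover have "\<exists>C D. N3 (of_int 3 + of_int (- 1) * X + 5 * (X - 1) * (of_int C * X + of_int D)) = of_int (int p)"
  proof -
    \<comment> \<open>\<open>a' + b' \<omega> = - \<omega> (a + b \<omega>)\<close>\<close>
    define a' b' where "a' = b" and "b' = b - a"
    \<comment> \<open>The residue 4 stands for the coefficient -1 of \<open>3 - X\<close>.\<close>
    have ab': "a'\<^sup>2 - a' * b' + b'\<^sup>2 = int p" "a' mod 5 = 3" "b' mod 5 = 4"
      using ab by (simp_all add: a'_def b'_def power2_eq_square algebra_simps) presburger
    consider "(a' + b') mod 3 = 2" | "(a' + b') mod 3 = 1"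
      using eisenstein_norm_not_dvd_3[of a' b'] p ab'(1) by auto
    thus ?thesis
    proof cases
      case 1
      thus ?thesis using ab' by (intro exists_N3_affine_ramified[of a' _ b']) auto
    next
      case 2
      \<comment> \<open>\<open>a' + (a' - b') \<omega>\<close> is \<open>- \<omega>\<^sup>2\<close> times the conjugate of \<open>a' + b' \<omega>\<close>\<close>
      have "(a' - b') mod 5 = 4"
        using ab'(2,3) by presburger
      moreover have "(a' + (a' - b')) mod 3 = 2"
        using 2 by presburger
      moreover have "a'\<^sup>2 - a' * (a' - b') + (a' - b')\<^sup>2 = int p"
        using ab'(1) by (simp add: power2_eq_square algebra_simps)
      ultimately show ?thesis
        using ab'(2) by (intro exists_N3_affine_ramified[of a' _ "a' - b'"]) auto
    qed
  qed
  ultimately show "\<exists>A B C D :: int.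
      N3 (4 + 3 * X + 5 * (of_int A * X + of_int B)) = of_nat p \<and>
      N3 (3 - X + 5 * (X - 1) * (of_int C * X + of_int D)) = of_nat p"
    unfolding of_int_minus of_int_1 of_int_numeral of_int_of_nat_eq mult_minus1 mult_1
      add_uminus_conv_diff by blast
qed

end
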